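(* Let $E$ be a vector bundle over a manifold $M$, and let $u^M\colon C^\infty(M)\to C^\infty(M)$ and $u\colon\Gamma E\to\Gamma E$ be $\mathbb R$-linear isomorphisms. Then $u^M+u$ is an algebra automorphism of $\mathcal A(E)$ if and only if (i) $u^M$ is an algebra automorphism of $C^\infty(M)$, and (ii) $u$ is a semi-linear isomorphism of $\Gamma E$ with associated automorphism $u^M$ of $C^\infty(M)$.
   Context: All manifolds are smooth and second countable. $C^\infty(M)$ is the algebra of smooth real-valued functions on $M$ and $\Gamma E$ the $C^\infty(M)$-module of smooth sections of $E$. $\mathcal A(E)$ is the vector space $C^\infty(M)\oplus\Gamma E$ with the commutative $\mathbb R$-algebra structure in which the product of two elements of $C^\infty(M)$ is their product in $C^\infty(M)$, the product of $f\in C^\infty(M)$ and $\psi\in\Gamma E$ is $f\psi$ in the $C^\infty(M)$-module $\Gamma E$, and the product of any two elements of $\Gamma E$ is zero. $u^M+u$ denotes the linear endomorphism of $\mathcal A(E)$ equal to $u^M$ on $C^\infty(M)$ and to $u$ on $\Gamma E$. $u$ is a semi-linear isomorphism of $\Gamma E$ with associated automorphism $u^M$ if $u$ is an $\mathbb R$-linear automorphism of $\Gamma E$ and $u(f\psi)=u^M(f)\,u(\psi)$ for all $f\in C^\infty(M)$, $\psi\in\Gamma E$. *)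

theory Defs
  imports "HOL-Analysis.Analysis" "HOL-Algebra.Module" "HOL-Algebra.Algebraic_Closure_Type"
begin

section \<open>Smooth functions on open subsets of Euclidean space\<close>

text \<open>
  The model space is \<^term>\<open>Euclidean_space n\<close>, i.e. the functions \<open>nat \<Rightarrow> real\<close> vanishing from
  index \<open>n\<close> on, so that every dimension \<open>n \<ge> 0\<close> is covered. A function is of class \<open>C\<^sup>k\<close> on an
  open set \<open>V\<close> iff all its iterated partial derivatives of order at most \<open>k\<close> exist and are
  continuous on \<open>V\<close>. The values of \<open>f\<close> off \<open>V\<close> are irrelevant: for \<open>x \<in> V\<close> and \<open>i < n\<close> the point
  \<open>x(i := t)\<close> lies in \<open>V\<close> for \<open>t\<close> near \<open>x i\<close>.
\<close>

primrec Ck_on :: "nat \<Rightarrow> nat \<Rightarrow> (nat \<Rightarrow> real) set \<Rightarrow> ((nat \<Rightarrow> real) \<Rightarrow> real) \<Rightarrow> bool" where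
  "Ck_on n 0 V f \<longleftrightarrow> continuous_map (subtopology (Euclidean_space n) V) euclideanreal f"
| "Ck_on n (Suc k) V f \<longleftrightarrow>
     continuous_map (subtopology (Euclidean_space n) V) euclideanreal f \<and>
     (\<forall>i<n. \<exists>g. (\<forall>x\<in>V. ((\<lambda>t. f (x(i := t))) has_real_derivative g x) (at (x i))) \<and> Ck_on n k V g)"

definition smooth_fun_on :: "nat \<Rightarrow> (nat \<Rightarrow> real) set \<Rightarrow> ((nat \<Rightarrow> real) \<Rightarrow> real) \<Rightarrow> bool" where
  "smooth_fun_on n V f \<longleftrightarrow> (\<forall>k. Ck_on n k V f)"


section \<open>Smooth manifolds\<close>

record 'a manifold =
  mtop :: "'a topology"
  mdim :: nat
  atlas :: "('a set \<times> ('a \<Rightarrow> nat \<Rightarrow> real)) set"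

abbreviation points :: "('a, 'm) manifold_scheme \<Rightarrow> 'a set" where
  "points M \<equiv> topspace (mtop M)"

definition chart :: "('a, 'm) manifold_scheme \<Rightarrow> 'a set \<Rightarrow> ('a \<Rightarrow> nat \<Rightarrow> real) \<Rightarrow> bool" where
  "chart M U \<phi> \<longleftrightarrow>
     openin (mtop M) U \<and> openin (Euclidean_space (mdim M)) (\<phi> ` U) \<and>
     homeomorphic_map (subtopology (mtop M) U) (subtopology (Euclidean_space (mdim M)) (\<phi> ` U)) \<phi>"

text \<open>The atlas need not be maximal; smoothness of functions only depends on the maximal atlas
  it generates.\<close>

definition smooth_manifold :: "('a, 'm) manifold_scheme \<Rightarrow> bool" where
  "smooth_manifold M \<longleftrightarrow>
     Hausdorff_space (mtop M) \<and> second_countable (mtop M) \<and>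
     (\<forall>(U, \<phi>) \<in> atlas M. chart M U \<phi>) \<and>
     (\<Union>(U, \<phi>) \<in> atlas M. U) = points M \<and>
     (\<forall>(U, \<phi>) \<in> atlas M. \<forall>(U', \<phi>') \<in> atlas M. \<forall>i < mdim M.
        smooth_fun_on (mdim M) (\<phi> ` (U \<inter> U')) (\<lambda>y. \<phi>' (inv_into U \<phi> y) i))"

text \<open>To be applied to open sets \<open>W\<close> only.\<close>

definition smooth_on_open :: "('a, 'm) manifold_scheme \<Rightarrow> 'a set \<Rightarrow> ('a \<Rightarrow> real) \<Rightarrow> bool" where
  "smooth_on_open M W f \<longleftrightarrow>
     (\<forall>(U, \<phi>) \<in> atlas M. smooth_fun_on (mdim M) (\<phi> ` (U \<inter> W)) (\<lambda>y. f (inv_into U \<phi> y)))"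


section \<open>Smooth vector bundles\<close>

text \<open>
  The fibre over \<open>x\<close> is a real vector space, given as a module record over the field of real
  numbers. A local trivialization over an open set \<open>U\<close> is a homeomorphism
  \<open>e \<mapsto> (proj E e, \<tau> e)\<close> from the part of the total space over \<open>U\<close> to \<open>U \<times> \<real>\<^sup>r\<close>, linear on fibres;
  only the component \<open>\<tau>\<close> is recorded. The smooth structure of the bundle is given by the requirement
  that the transition functions \<open>U \<inter> U' \<rightarrow> GL(r)\<close> be smooth (their values are invertible matrices
  since trivializations are bijective on fibres).
\<close>

abbreviation real_field :: "real ring" where
  "real_field \<equiv> ring_of_type_algebra"

record ('a, 'e) vbundle =
  total :: "'e topology"
  proj :: "'e \<Rightarrow> 'a"
  fibre :: "'a \<Rightarrow> (real, 'e) module"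
  vrank :: nat
  trivs :: "('a set \<times> ('e \<Rightarrow> nat \<Rightarrow> real)) set"

definition local_triv ::
  "('a, 'm) manifold_scheme \<Rightarrow> ('a, 'e, 'b) vbundle_scheme \<Rightarrow> 'a set \<Rightarrow> ('e \<Rightarrow> nat \<Rightarrow> real) \<Rightarrow> bool"
where
  "local_triv M E U \<tau> \<longleftrightarrow>
     openin (mtop M) U \<and>
     homeomorphic_map
       (subtopology (total E) {e \<in> topspace (total E). proj E e \<in> U})
       (prod_topology (subtopology (mtop M) U) (Euclidean_space (vrank E)))
       (\<lambda>e. (proj E e, \<tau> e)) \<and>
     (\<forall>x\<in>U. \<forall>e \<in> carrier (fibre E x). \<forall>e' \<in> carrier (fibre E x). \<forall>i.
        \<tau> (e \<oplus>\<^bsub>fibre E x\<^esub> e') i = \<tau> e i + \<tau> e' i) \<and>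
     (\<forall>x\<in>U. \<forall>c. \<forall>e \<in> carrier (fibre E x). \<forall>i. \<tau> (c \<odot>\<^bsub>fibre E x\<^esub> e) i = c * \<tau> e i)"

definition smooth_transition ::
  "('a, 'm) manifold_scheme \<Rightarrow> ('a, 'e, 'b) vbundle_scheme \<Rightarrow>
   'a set \<times> ('e \<Rightarrow> nat \<Rightarrow> real) \<Rightarrow> 'a set \<times> ('e \<Rightarrow> nat \<Rightarrow> real) \<Rightarrow> bool"
where
  "smooth_transition M E = (\<lambda>(U, \<tau>) (U', \<tau>').
     \<exists>g :: nat \<Rightarrow> nat \<Rightarrow> 'a \<Rightarrow> real.
       (\<forall>i < vrank E. \<forall>j < vrank E. smooth_on_open M (U \<inter> U') (g i j)) \<and>
       (\<forall>x \<in> U \<inter> U'. \<forall>e \<in> carrier (fibre E x). \<forall>i < vrank E.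
          \<tau>' e i = (\<Sum>j < vrank E. g i j x * \<tau> e j)))"

definition vector_bundle ::
  "('a, 'm) manifold_scheme \<Rightarrow> ('a, 'e, 'b) vbundle_scheme \<Rightarrow> bool"
where
  "vector_bundle M E \<longleftrightarrow>
     continuous_map (total E) (mtop M) (proj E) \<and>
     (\<forall>x \<in> points M. Module.module real_field (fibre E x) \<and>
        carrier (fibre E x) = {e \<in> topspace (total E). proj E e = x}) \<and>
     (\<forall>(U, \<tau>) \<in> trivs E. local_triv M E U \<tau>) \<and>
     (\<Union>(U, \<tau>) \<in> trivs E. U) = points M \<and>
     (\<forall>t \<in> trivs E. \<forall>t' \<in> trivs E. smooth_transition M E t t')"

definition smooth_section ::
  "('a, 'm) manifold_scheme \<Rightarrow> ('a, 'e, 'b) vbundle_scheme \<Rightarrow> ('a \<Rightarrow> 'e) \<Rightarrow> bool"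
where
  "smooth_section M E \<psi> \<longleftrightarrow>
     (\<forall>x \<in> points M. \<psi> x \<in> carrier (fibre E x)) \<and>
     (\<forall>(U, \<tau>) \<in> trivs E. \<forall>i < vrank E. smooth_on_open M U (\<lambda>x. \<tau> (\<psi> x) i))"


section \<open>Algebras and modules of functions and sections\<close>

text \<open>Functions and sections are taken to be \<^const>\<open>undefined\<close> off the manifold
  (\<^const>\<open>extensional\<close>), so that HOL equality of them is equality on the manifold.\<close>

definition smooth_algebra :: "('a, 'm) manifold_scheme \<Rightarrow> (real, 'a \<Rightarrow> real) module" where
  "smooth_algebra M =
    \<lparr> carrier = {f \<in> extensional (points M). smooth_on_open M (points M) f},
      mult = (\<lambda>f g. \<lambda>x\<in>points M. f x * g x),
      one = (\<lambda>x\<in>points M. 1),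
      zero = (\<lambda>x\<in>points M. 0),
      add = (\<lambda>f g. \<lambda>x\<in>points M. f x + g x),
      smult = (\<lambda>c f. \<lambda>x\<in>points M. c * f x) \<rparr>"

text \<open>Sections as a module over \<^const>\<open>smooth_algebra\<close>, and as a real vector space. Every module
  record has fields \<open>mult\<close> and \<open>one\<close>; they are meaningless here.\<close>

definition section_module ::
  "('a, 'm) manifold_scheme \<Rightarrow> ('a, 'e, 'b) vbundle_scheme \<Rightarrow> ('a \<Rightarrow> real, 'a \<Rightarrow> 'e) module"
where
  "section_module M E =
    \<lparr> carrier = {\<psi> \<in> extensional (points M). smooth_section M E \<psi>},
      mult = undefined,
      one = undefined,
      zero = (\<lambda>x\<in>points M. \<zero>\<^bsub>fibre E x\<^esub>),
      add = (\<lambda>\<psi> \<xi>. \<lambda>x\<in>points M. \<psi> x \<oplus>\<^bsub>fibre E x\<^esub> \<xi> x),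
      smult = (\<lambda>f \<psi>. \<lambda>x\<in>points M. f x \<odot>\<^bsub>fibre E x\<^esub> \<psi> x) \<rparr>"

definition section_space ::
  "('a, 'm) manifold_scheme \<Rightarrow> ('a, 'e, 'b) vbundle_scheme \<Rightarrow> (real, 'a \<Rightarrow> 'e) module"
where
  "section_space M E =
    \<lparr> carrier = carrier (section_module M E),
      mult = undefined,
      one = undefined,
      zero = zero (section_module M E),
      add = add (section_module M E),
      smult = (\<lambda>c \<psi>. \<lambda>x\<in>points M. c \<odot>\<^bsub>fibre E x\<^esub> \<psi> x) \<rparr>"

text \<open>The algebra \<open>\<A>(E)\<close>. By bilinearity, the prescribed products of elements of the two summands
  amount to \<open>(f, \<psi>) (g, \<xi>) = (f g, f \<xi> + g \<psi>)\<close>.\<close>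

definition bundle_algebra ::
  "('a, 'm) manifold_scheme \<Rightarrow> ('a, 'e, 'b) vbundle_scheme \<Rightarrow>
   (real, ('a \<Rightarrow> real) \<times> ('a \<Rightarrow> 'e)) module"
where
  "bundle_algebra M E =
    \<lparr> carrier = carrier (smooth_algebra M) \<times> carrier (section_module M E),
      mult = (\<lambda>(f, \<psi>) (g, \<xi>).
        (f \<otimes>\<^bsub>smooth_algebra M\<^esub> g,
         (f \<odot>\<^bsub>section_module M E\<^esub> \<xi>) \<oplus>\<^bsub>section_module M E\<^esub> (g \<odot>\<^bsub>section_module M E\<^esub> \<psi>))),
      one = (\<one>\<^bsub>smooth_algebra M\<^esub>, \<zero>\<^bsub>section_module M E\<^esub>),
      zero = (\<zero>\<^bsub>smooth_algebra M\<^esub>, \<zero>\<^bsub>section_module M E\<^esub>),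
      add = (\<lambda>(f, \<psi>) (g, \<xi>). (f \<oplus>\<^bsub>smooth_algebra M\<^esub> g, \<psi> \<oplus>\<^bsub>section_module M E\<^esub> \<xi>)),
      smult = (\<lambda>c (f, \<psi>). (c \<odot>\<^bsub>smooth_algebra M\<^esub> f, c \<odot>\<^bsub>section_space M E\<^esub> \<psi>)) \<rparr>"


section \<open>Automorphisms\<close>

text \<open>Only the restriction of a map to the carriers matters in the following notions.\<close>

definition linear_auto :: "(real, 'v, 'k) module_scheme \<Rightarrow> ('v \<Rightarrow> 'v) \<Rightarrow> bool" where
  "linear_auto V h \<longleftrightarrow>
     bij_betw h (carrier V) (carrier V) \<and>
     (\<forall>v \<in> carrier V. \<forall>w \<in> carrier V. h (v \<oplus>\<^bsub>V\<^esub> w) = h v \<oplus>\<^bsub>V\<^esub> h w) \<and>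
     (\<forall>c. \<forall>v \<in> carrier V. h (c \<odot>\<^bsub>V\<^esub> v) = c \<odot>\<^bsub>V\<^esub> h v)"

definition algebra_auto :: "(real, 'v, 'k) module_scheme \<Rightarrow> ('v \<Rightarrow> 'v) \<Rightarrow> bool" where
  "algebra_auto A h \<longleftrightarrow> linear_auto A h \<and> h \<in> ring_iso A A"

definition semilinear_iso ::
  "('a, 'm) manifold_scheme \<Rightarrow> ('a, 'e, 'b) vbundle_scheme \<Rightarrow>
   (('a \<Rightarrow> real) \<Rightarrow> 'a \<Rightarrow> real) \<Rightarrow> (('a \<Rightarrow> 'e) \<Rightarrow> 'a \<Rightarrow> 'e) \<Rightarrow> bool"
where
  "semilinear_iso M E uM u \<longleftrightarrow>
     linear_auto (section_space M E) u \<and>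
     (\<forall>f \<in> carrier (smooth_algebra M). \<forall>\<psi> \<in> carrier (section_module M E).
        u (f \<odot>\<^bsub>section_module M E\<^esub> \<psi>) = uM f \<odot>\<^bsub>section_module M E\<^esub> u \<psi>)"

end

theory Submission
  imports Defs
begin

text \<open>The product on \<open>bundle_algebra M E\<close> is (f, psi)(g, xi) = (f g, f xi + g
  psi), with unit (1, 0). The map \<open>map_prod uM u\<close> is diagonal, so its bijectivity and
  linearity come from the hypotheses on \<open>uM\<close> and \<open>u\<close>; only products and
  the unit carry information. If it is multiplicative, evaluating on (f, 0)(g, 0) makes
  \<open>uM\<close> multiplicative, and evaluating on (f, 0)(0, psi) = (0, f psi) gives
  semi-linearity of \<open>u\<close>. Conversely, u(f xi + g psi) = uM(f) u(xi) + uM(g) u(psi) by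
  additivity and semi-linearity, which is the section component of the product of the images.

  To run this on the concrete carriers, the zero function and zero section must be smooth
  (\<open>zero_in_smooth_algebra\<close>, \<open>zero_in_section_module\<close>) and fixed by the
  maps (\<open>linear_auto_zero\<close>), and f psi must be a smooth section
  (\<open>smult_in_section_module\<close>). The last rests on the product rule
  (\<open>Ck_on_mult\<close>) and on smoothness being a local property
  (\<open>Ck_on_cong\<close>).\<close>

section \<open>Functions of class C^k\<close>

lemma Ck_on_continuous: "Ck_on n k V f \<Longrightarrow> continuous_map (subtopology (Euclidean_space n) V) euclideanreal f"
  by (cases k) auto

lemma Ck_on_SucD:
  assumes "Ck_on n (Suc k) V f" "i < n"
  shows "\<exists>f'. (\<forall>x\<in>V. ((\<lambda>t. f (x(i := t))) has_real_derivative f' x) (at (x i))) \<and> Ck_on n k V f'"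
  using assms unfolding Ck_on.simps by (elim conjE) (drule spec, drule mp, assumption+)

lemma Ck_on_SucI:
  assumes "continuous_map (subtopology (Euclidean_space n) V) euclideanreal f"
    and "\<And>i. i < n \<Longrightarrow>
      \<exists>f'. (\<forall>x\<in>V. ((\<lambda>t. f (x(i := t))) has_real_derivative f' x) (at (x i))) \<and> Ck_on n k V f'"
  shows "Ck_on n (Suc k) V f"
  using assms unfolding Ck_on.simps by (intro conjI allI impI)

text \<open>The partial derivatives of f lose one order by induction. In the product rule this
  brings the undifferentiated factors down to the order of the differentiated ones.\<close>

lemma Ck_on_Suc_imp: "Ck_on n (Suc k) V f \<Longrightarrow> Ck_on n k V f"
proof (induction k arbitrary: f)
  case 0
  then show ?case by simp
next
  case (Suc k)
  show ?case
  proof (rule Ck_on_SucI)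
    fix i assume "i < n"
    from Ck_on_SucD[OF Suc.prems this] obtain f' where
      f': "\<forall>x\<in>V. ((\<lambda>t. f (x(i := t))) has_real_derivative f' x) (at (x i))" "Ck_on n (Suc k) V f'"
      by (elim exE conjE)
    then show "\<exists>f'. (\<forall>x\<in>V. ((\<lambda>t. f (x(i := t))) has_real_derivative f' x) (at (x i))) \<and> Ck_on n k V f'"
      by (intro exI[of _ f'] conjI Suc.IH)
  qed (rule Ck_on_continuous[OF Suc.prems])
qed

text \<open>The derivatives are taken along full coordinate lines, independently of V, so the same
  partial derivatives serve on V'.\<close>

lemma Ck_on_subset: "Ck_on n k V f \<Longrightarrow> V' \<subseteq> V \<Longrightarrow> Ck_on n k V' f"
proof (induction k arbitrary: f)
  case 0
  then show ?case by (auto intro: continuous_map_from_subtopology_mono)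
next
  case (Suc k)
  show ?case
  proof (rule Ck_on_SucI)
    fix i assume "i < n"
    from Ck_on_SucD[OF Suc.prems(1) this] obtain f' where
      f': "\<forall>x\<in>V. ((\<lambda>t. f (x(i := t))) has_real_derivative f' x) (at (x i))" "Ck_on n k V f'"
      by (elim exE conjE)
    then show "\<exists>f'. (\<forall>x\<in>V'. ((\<lambda>t. f (x(i := t))) has_real_derivative f' x) (at (x i))) \<and> Ck_on n k V' f'"
      using Suc.IH[OF f'(2)] Suc.prems(2) by (intro exI[of _ f'] conjI) auto
  qed (rule continuous_map_from_subtopology_mono[OF Ck_on_continuous[OF Suc.prems(1)] Suc.prems(2)])
qed

lemma Ck_on_zero: "Ck_on n k V (\<lambda>_. 0)"
  by (induction k) (auto intro!: exI[where x = "\<lambda>_. 0"])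

lemma Ck_on_add:
  "Ck_on n k V f \<Longrightarrow> Ck_on n k V g \<Longrightarrow> Ck_on n k V (\<lambda>x. f x + g x)"
proof (induction k arbitrary: f g)
  case 0
  then show ?case by (auto intro: continuous_map_add)
next
  case (Suc k)
  have "\<exists>d. (\<forall>x\<in>V. ((\<lambda>t. f (x(i := t)) + g (x(i := t))) has_real_derivative d x) (at (x i))) \<and> Ck_on n k V d"
    if i: "i < n" for i
  proof -
    obtain f' where
      f': "\<forall>x\<in>V. ((\<lambda>t. f (x(i := t))) has_real_derivative f' x) (at (x i))" "Ck_on n k V f'"
      using Ck_on_SucD[OF Suc.prems(1) i] by (elim exE conjE)
    obtain g' where
      g': "\<forall>x\<in>V. ((\<lambda>t. g (x(i := t))) has_real_derivative g' x) (at (x i))" "Ck_on n k V g'"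
      using Ck_on_SucD[OF Suc.prems(2) i] by (elim exE conjE)
    show ?thesis
      by (rule exI[where x = "\<lambda>x. f' x + g' x"]) (use f' g' Suc.IH in \<open>auto intro!: DERIV_add\<close>)
  qed
  then show ?case
    using continuous_map_add[OF Suc.prems[THEN Ck_on_continuous]] by (intro Ck_on_SucI)
qed

text \<open>Leibniz rule. The induction hypothesis is applied to the pairs (f', g) and (g', f),
  hence the generalization over both factors.\<close>

lemma Ck_on_mult:
  "Ck_on n k V f \<Longrightarrow> Ck_on n k V g \<Longrightarrow> Ck_on n k V (\<lambda>x. f x * g x)"
proof (induction k arbitrary: f g)
  case 0
  then show ?case by (auto intro: continuous_map_real_mult)
next
  case (Suc k)
  have "\<exists>d. (\<forall>x\<in>V. ((\<lambda>t. f (x(i := t)) * g (x(i := t))) has_real_derivative d x) (at (x i))) \<and> Ck_on n k V d"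
    if i: "i < n" for i
  proof -
    obtain f' where
      f': "\<forall>x\<in>V. ((\<lambda>t. f (x(i := t))) has_real_derivative f' x) (at (x i))" "Ck_on n k V f'"
      using Ck_on_SucD[OF Suc.prems(1) i] by (elim exE conjE)
    obtain g' where
      g': "\<forall>x\<in>V. ((\<lambda>t. g (x(i := t))) has_real_derivative g' x) (at (x i))" "Ck_on n k V g'"
      using Ck_on_SucD[OF Suc.prems(2) i] by (elim exE conjE)
    have "((\<lambda>t. f (x(i := t)) * g (x(i := t))) has_real_derivative f' x * g x + g' x * f x) (at (x i))"
      if "x \<in> V" for x
      using DERIV_mult[OF bspec[OF f'(1) that] bspec[OF g'(1) that]] by simp
    moreover have "Ck_on n k V (\<lambda>x. f' x * g x + g' x * f x)"
      using f' g' Suc.prems by (intro Ck_on_add Suc.IH) (auto intro: Ck_on_Suc_imp simp del: Ck_on.simps)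
    ultimately show ?thesis
      by (intro exI[of _ "\<lambda>x. f' x * g x + g' x * f x"] conjI ballI)
  qed
  then show ?case
    using continuous_map_real_mult[OF Suc.prems[THEN Ck_on_continuous]] by (intro Ck_on_SucI)
qed

text \<open>The coordinate line through x stays in \<open>Euclidean_space n\<close> because i < n,
  and it is continuous in t. The preimage of V is therefore an open set of parameters, and it
  contains x i.\<close>

lemma eventually_fun_upd_in_open:
  assumes V: "openin (Euclidean_space n) V" and "x \<in> V" "i < n"
  shows "eventually (\<lambda>t. x(i := t) \<in> V) (at (x i))"
proof -
  have x: "x j = 0" if "j \<ge> n" for j
    using openin_subset[OF V] \<open>x \<in> V\<close> that by (auto simp: topspace_Euclidean_space)
  have "continuous_map euclideanreal (Euclidean_space n) (\<lambda>t. x(i := t))"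
    unfolding Euclidean_space_def continuous_map_in_subtopology continuous_map_componentwise_UNIV
    using x \<open>i < n\<close> by auto
  then have "openin euclideanreal {t \<in> topspace euclideanreal. x(i := t) \<in> V}"
    using V by (rule openin_continuous_map_preimage)
  then have "open {t. x(i := t) \<in> V}" by simp
  with \<open>x \<in> V\<close> show ?thesis
    by (auto simp: eventually_at_topological)
qed

text \<open>A partial derivative looks at values along a coordinate line, which may leave V;
  openness of V keeps the line inside near x. Hence f and g have the same partial derivatives on V,
  and a case distinction on k suffices in place of an induction.\<close>

lemma Ck_on_cong:
  assumes V: "openin (Euclidean_space n) V" and eq: "\<And>x. x \<in> V \<Longrightarrow> f x = g x" and f: "Ck_on n k V f"
  shows "Ck_on n k V g"
proof -
  have cont: "continuous_map (subtopology (Euclidean_space n) V) euclideanreal g"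
    by (rule continuous_map_eq[OF Ck_on_continuous[OF f]]) (use eq in auto)
  have deriv: "((\<lambda>t. g (x(i := t))) has_real_derivative d) (at (x i))"
    if "((\<lambda>t. f (x(i := t))) has_real_derivative d) (at (x i))" "x \<in> V" "i < n" for x i d
  proof -
    have "\<forall>\<^sub>F t in at (x i). f (x(i := t)) = g (x(i := t))"
      using eventually_fun_upd_in_open[OF V that(2,3)] by eventually_elim (rule eq)
    \<comment> \<open>The filter \<open>at (x i)\<close> omits the centre, but the difference
      quotient uses the value there.\<close>
    moreover have "f (x(i := x i)) = g (x(i := x i))" using eq that(2) by simp
    ultimately show ?thesis
      using that(1) by (subst (asm) has_field_derivative_cong_eventually) auto
  qed
  show ?thesis
  proof (cases k)
    case 0
    with cont show ?thesis by simp
  next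
    case (Suc l)
    show ?thesis
      unfolding Suc
    proof (rule Ck_on_SucI[OF cont])
      fix i assume i: "i < n"
      from Ck_on_SucD[OF f[unfolded Suc] i] obtain f' where
        f': "\<forall>x\<in>V. ((\<lambda>t. f (x(i := t))) has_real_derivative f' x) (at (x i))" "Ck_on n l V f'"
        by (elim exE conjE)
      with deriv[OF _ _ i] show
        "\<exists>f'. (\<forall>x\<in>V. ((\<lambda>t. g (x(i := t))) has_real_derivative f' x) (at (x i))) \<and> Ck_on n l V f'"
        by (intro exI[of _ f'] conjI ballI) auto
    qed
  qed
qed

section \<open>Smooth functions on a manifold\<close>

text \<open>A homeomorphism onto \<phi> \<open>U makes the image relatively open, and \<phi>\<close>
  U is itself open in the model space. This supplies the openness that \<open>Ck_on_cong\<close>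
  asks for.\<close>

lemma openin_chart_image:
  assumes "chart M U \<phi>" "openin (mtop M) W"
  shows "openin (Euclidean_space (mdim M)) (\<phi> ` (U \<inter> W))"
proof -
  have "openin (subtopology (mtop M) U) (U \<inter> W)"
    using assms(2) by (auto simp: openin_subtopology)
  then have "openin (subtopology (Euclidean_space (mdim M)) (\<phi> ` U)) (\<phi> ` (U \<inter> W))"
    using assms(1) homeomorphic_imp_open_map unfolding chart_def open_map_def by blast
  then show ?thesis
    using assms(1) unfolding chart_def by (meson openin_trans_full)
qed

lemma inv_into_chart:
  assumes "chart M U \<phi>" "x \<in> U"
  shows "inv_into U \<phi> (\<phi> x) = x"
proof -
  have "U \<subseteq> topspace (mtop M)" using assms(1) by (auto simp: chart_def dest: openin_subset)
  then have "inj_on \<phi> U"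
    using assms(1) unfolding chart_def homeomorphic_eq_everything_map
    by (auto simp: Int_absorb1)
  with assms(2) show ?thesis by simp
qed

text \<open>Elements of the carriers are restricted functions, undefined off the manifold. This
  lemma trades them for the plain formulas to which the closure rules apply.\<close>

lemma smooth_on_open_cong:
  assumes "smooth_manifold M" "openin (mtop M) W" "\<And>x. x \<in> W \<Longrightarrow> f x = g x" "smooth_on_open M W f"
  shows "smooth_on_open M W g"
  unfolding smooth_on_open_def
proof clarify
  fix U \<phi> assume at: "(U, \<phi>) \<in> atlas M"
  with assms(1) have ch: "chart M U \<phi>" by (auto simp: smooth_manifold_def)
  have "smooth_fun_on (mdim M) (\<phi> ` (U \<inter> W)) (\<lambda>y. f (inv_into U \<phi> y))"
    using assms(4) at by (auto simp: smooth_on_open_def)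
  moreover have "f (inv_into U \<phi> y) = g (inv_into U \<phi> y)" if "y \<in> \<phi> ` (U \<inter> W)" for y
    using that assms(3) inv_into_chart[OF ch] by auto
  ultimately show "smooth_fun_on (mdim M) (\<phi> ` (U \<inter> W)) (\<lambda>y. g (inv_into U \<phi> y))"
    unfolding smooth_fun_on_def
    by (intro allI, elim allE) (rule Ck_on_cong[OF openin_chart_image[OF ch assms(2)]])
qed

lemma smooth_on_open_subset:
  assumes "smooth_on_open M W f" "W' \<subseteq> W"
  shows "smooth_on_open M W' f"
  unfolding smooth_on_open_def smooth_fun_on_def
proof clarify
  fix U \<phi> k assume "(U, \<phi>) \<in> atlas M"
  with assms(1) have "Ck_on (mdim M) k (\<phi> ` (U \<inter> W)) (\<lambda>y. f (inv_into U \<phi> y))"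
    by (auto simp: smooth_on_open_def smooth_fun_on_def)
  then show "Ck_on (mdim M) k (\<phi> ` (U \<inter> W')) (\<lambda>y. f (inv_into U \<phi> y))"
    by (rule Ck_on_subset) (use assms(2) in auto)
qed

lemma smooth_on_open_zero: "smooth_on_open M W (\<lambda>_. 0)"
  by (simp add: smooth_on_open_def smooth_fun_on_def Ck_on_zero)

lemma smooth_on_open_mult:
  assumes "smooth_on_open M W f" "smooth_on_open M W g"
  shows "smooth_on_open M W (\<lambda>x. f x * g x)"
  unfolding smooth_on_open_def smooth_fun_on_def
proof clarify
  fix U \<phi> k assume "(U, \<phi>) \<in> atlas M"
  with assms have "Ck_on (mdim M) k (\<phi> ` (U \<inter> W)) (\<lambda>y. f (inv_into U \<phi> y))"
    "Ck_on (mdim M) k (\<phi> ` (U \<inter> W)) (\<lambda>y. g (inv_into U \<phi> y))"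
    by (auto simp: smooth_on_open_def smooth_fun_on_def)
  then show "Ck_on (mdim M) k (\<phi> ` (U \<inter> W)) (\<lambda>y. f (inv_into U \<phi> y) * g (inv_into U \<phi> y))"
    by (rule Ck_on_mult)
qed

lemma zero_in_smooth_algebra:
  assumes "smooth_manifold M"
  shows "\<zero>\<^bsub>smooth_algebra M\<^esub> \<in> carrier (smooth_algebra M)"
  using smooth_on_open_cong[OF assms openin_topspace _ smooth_on_open_zero,
      of "\<lambda>x\<in>points M. 0"]
  by (auto simp: smooth_algebra_def)

section \<open>Sections of a vector bundle\<close>

lemma fibre_module:
  assumes "vector_bundle M E" "x \<in> points M"
  shows "Module.module real_field (fibre E x)"
  using assms by (auto simp: vector_bundle_def)

text \<open>Apply additivity of \<tau> on the fibre to 0 + 0 = 0.\<close>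

lemma local_triv_zero:
  assumes "vector_bundle M E" "(U, \<tau>) \<in> trivs E" "x \<in> U"
  shows "\<tau> \<zero>\<^bsub>fibre E x\<^esub> i = 0"
proof -
  have lt: "local_triv M E U \<tau>" using assms by (auto simp: vector_bundle_def)
  with \<open>x \<in> U\<close> have "x \<in> points M" by (auto simp: local_triv_def dest: openin_subset)
  interpret F: Module.module real_field "fibre E x"
    by (rule fibre_module) fact+
  have "\<tau> (\<zero>\<^bsub>fibre E x\<^esub> \<oplus>\<^bsub>fibre E x\<^esub> \<zero>\<^bsub>fibre E x\<^esub>) i = \<tau> \<zero>\<^bsub>fibre E x\<^esub> i + \<tau> \<zero>\<^bsub>fibre E x\<^esub> i"
    using lt \<open>x \<in> U\<close> F.M.zero_closed unfolding local_triv_def by blast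
  then show ?thesis by simp
qed

lemma zero_in_section_module:
  assumes M: "smooth_manifold M" and E: "vector_bundle M E"
  shows "\<zero>\<^bsub>section_module M E\<^esub> \<in> carrier (section_module M E)"
proof -
  have "\<zero>\<^bsub>fibre E x\<^esub> \<in> carrier (fibre E x)" if "x \<in> points M" for x
  proof -
    interpret F: Module.module real_field "fibre E x"
      by (rule fibre_module) fact+
    show ?thesis by simp
  qed
  moreover have "smooth_on_open M U (\<lambda>x. \<tau> ((\<lambda>x\<in>points M. \<zero>\<^bsub>fibre E x\<^esub>) x) i)"
    if t: "(U, \<tau>) \<in> trivs E" for U \<tau> i
  proof -
    have U: "openin (mtop M) U" using t E by (auto simp: vector_bundle_def local_triv_def)
    show ?thesis
      by (rule smooth_on_open_cong[OF M U _ smooth_on_open_zero])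
        (use local_triv_zero[OF E t] openin_subset[OF U] in auto)
  qed
  ultimately show ?thesis
    by (auto simp: section_module_def smooth_section_def simp del: restrict_apply)
      (simp add: restrict_apply)
qed

text \<open>By fibrewise linearity of \<tau>, the coordinates of f \<psi> in a trivialization are f
  times those of \<psi>, and products of smooth functions are smooth.\<close>

lemma smult_in_section_module:
  assumes M: "smooth_manifold M" and E: "vector_bundle M E"
    and f: "f \<in> carrier (smooth_algebra M)" and \<psi>: "\<psi> \<in> carrier (section_module M E)"
  shows "f \<odot>\<^bsub>section_module M E\<^esub> \<psi> \<in> carrier (section_module M E)"
proof -
  have \<psi>': "\<psi> x \<in> carrier (fibre E x)" if "x \<in> points M" for x
    using \<psi> that by (auto simp: section_module_def smooth_section_def)
  have "f x \<odot>\<^bsub>fibre E x\<^esub> \<psi> x \<in> carrier (fibre E x)" if "x \<in> points M" for x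
  proof -
    interpret F: Module.module real_field "fibre E x"
      by (rule fibre_module) fact+
    show ?thesis using \<psi>'[OF that] by (intro F.smult_closed) (auto simp: ring_of_type_algebra_def)
  qed
  moreover have "smooth_on_open M U (\<lambda>x. \<tau> ((\<lambda>x\<in>points M. f x \<odot>\<^bsub>fibre E x\<^esub> \<psi> x) x) i)"
    if t: "(U, \<tau>) \<in> trivs E" and i: "i < vrank E" for U \<tau> i
  proof -
    have lt: "local_triv M E U \<tau>" using t E by (auto simp: vector_bundle_def)
    then have U: "openin (mtop M) U" by (auto simp: local_triv_def)
    have "smooth_on_open M U f"
      using f openin_subset[OF U] by (auto simp: smooth_algebra_def intro: smooth_on_open_subset)
    moreover have "smooth_on_open M U (\<lambda>x. \<tau> (\<psi> x) i)"
      using \<psi> t i by (auto simp: section_module_def smooth_section_def)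
    ultimately have "smooth_on_open M U (\<lambda>x. f x * \<tau> (\<psi> x) i)"
      by (rule smooth_on_open_mult)
    then show ?thesis
      by (rule smooth_on_open_cong[OF M U, rotated])
        (use lt \<psi>' openin_subset[OF U] in \<open>auto simp: local_triv_def\<close>)
  qed
  ultimately show ?thesis
    by (auto simp: section_module_def smooth_section_def simp del: restrict_apply)
      (simp add: restrict_apply)
qed

section \<open>Scaling by zero\<close>

text \<open>The section component of (f, 0)(0, \<psi>) is f \<psi> + 0 0, with the zero function
  acting on the zero section. Computing in each fibre removes the second term.\<close>

lemma section_smult_add_zero:
  assumes E: "vector_bundle M E"
    and \<psi>: "\<psi> \<in> carrier (section_module M E)" and \<xi>: "\<xi> \<in> carrier (section_module M E)"
  shows "(f \<odot>\<^bsub>section_module M E\<^esub> \<psi>) \<oplus>\<^bsub>section_module M E\<^esub>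
      (\<zero>\<^bsub>smooth_algebra M\<^esub> \<odot>\<^bsub>section_module M E\<^esub> \<xi>) = f \<odot>\<^bsub>section_module M E\<^esub> \<psi>"
proof -
  have "(f x \<odot>\<^bsub>fibre E x\<^esub> \<psi> x) \<oplus>\<^bsub>fibre E x\<^esub> (0 \<odot>\<^bsub>fibre E x\<^esub> \<xi> x) = f x \<odot>\<^bsub>fibre E x\<^esub> \<psi> x"
    if "x \<in> points M" for x
  proof -
    interpret F: Module.module real_field "fibre E x"
      by (rule fibre_module) fact+
    have c: "\<psi> x \<in> carrier (fibre E x)" "\<xi> x \<in> carrier (fibre E x)"
      using \<psi> \<xi> that by (auto simp: section_module_def smooth_section_def)
    have "0 \<odot>\<^bsub>fibre E x\<^esub> \<xi> x = \<zero>\<^bsub>fibre E x\<^esub>"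
      using F.smult_l_null[OF c(2)] by (simp add: ring_of_type_algebra_def)
    moreover have "f x \<odot>\<^bsub>fibre E x\<^esub> \<psi> x \<in> carrier (fibre E x)"
      using c by (intro F.smult_closed) (auto simp: ring_of_type_algebra_def)
    ultimately show ?thesis by simp
  qed
  then show ?thesis
    by (auto simp: section_module_def smooth_algebra_def restrict_def)
qed

text \<open>h z = h (0 z) = 0 (h z) = z. Here V is a bare record without vector space axioms, so the
  behaviour of scaling by 0 enters as a hypothesis.\<close>

lemma linear_auto_zero:
  assumes "linear_auto V h" "z \<in> carrier V" "\<And>v. v \<in> carrier V \<Longrightarrow> 0 \<odot>\<^bsub>V\<^esub> v = z"
  shows "h z = z"
proof -
  have "h z \<in> carrier V" using assms(1,2) by (auto simp: linear_auto_def bij_betw_def)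
  then show ?thesis using assms unfolding linear_auto_def by metis
qed

text \<open>Supplies that hypothesis for sections; the scalar is the real number 0, not the zero
  function.\<close>

lemma section_zero_smult:
  assumes E: "vector_bundle M E" and \<psi>: "\<psi> \<in> carrier (section_space M E)"
  shows "0 \<odot>\<^bsub>section_space M E\<^esub> \<psi> = \<zero>\<^bsub>section_module M E\<^esub>"
proof -
  have "0 \<odot>\<^bsub>fibre E x\<^esub> \<psi> x = \<zero>\<^bsub>fibre E x\<^esub>" if "x \<in> points M" for x
  proof -
    interpret F: Module.module real_field "fibre E x"
      by (rule fibre_module) fact+
    have "\<psi> x \<in> carrier (fibre E x)"
      using \<psi> that by (auto simp: section_space_def section_module_def smooth_section_def)
    from F.smult_l_null[OF this] show ?thesis by (simp add: ring_of_type_algebra_def)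
  qed
  then show ?thesis
    by (auto simp: section_module_def section_space_def restrict_def)
qed

section \<open>Diagonal automorphisms of the bundle algebra\<close>

theorem proposition6p5:
  fixes M :: "'a manifold" and E :: "('a, 'e) vbundle"
    and uM :: "('a \<Rightarrow> real) \<Rightarrow> 'a \<Rightarrow> real" and u :: "('a \<Rightarrow> 'e) \<Rightarrow> 'a \<Rightarrow> 'e"
  assumes "smooth_manifold M"
    and "vector_bundle M E"
    and "linear_auto (smooth_algebra M) uM"
    and "linear_auto (section_space M E) u"
  shows "algebra_auto (bundle_algebra M E) (map_prod uM u) \<longleftrightarrow>
    algebra_auto (smooth_algebra M) uM \<and> semilinear_iso M E uM u"
proof -
  let ?C = "smooth_algebra M" and ?S = "section_module M E" and ?A = "bundle_algebra M E"
  \<comment> \<open>The two structures on sections differ in their scalars, reals or functions, but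
    share carrier and addition.\<close>
  have space: "carrier (section_space M E) = carrier ?S" "add (section_space M E) = add ?S"
    by (simp_all add: section_space_def)
  have A: "carrier ?A = carrier ?C \<times> carrier ?S"
    "\<And>f \<psi> g \<xi>. (f, \<psi>) \<otimes>\<^bsub>?A\<^esub> (g, \<xi>) =
      (f \<otimes>\<^bsub>?C\<^esub> g, (f \<odot>\<^bsub>?S\<^esub> \<xi>) \<oplus>\<^bsub>?S\<^esub> (g \<odot>\<^bsub>?S\<^esub> \<psi>))"
    "\<one>\<^bsub>?A\<^esub> = (\<one>\<^bsub>?C\<^esub>, \<zero>\<^bsub>?S\<^esub>)"
    "\<And>f \<psi> g \<xi>. (f, \<psi>) \<oplus>\<^bsub>?A\<^esub> (g, \<xi>) = (f \<oplus>\<^bsub>?C\<^esub> g, \<psi> \<oplus>\<^bsub>?S\<^esub> \<xi>)"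
    "\<And>c f \<psi>. c \<odot>\<^bsub>?A\<^esub> (f, \<psi>) = (c \<odot>\<^bsub>?C\<^esub> f, c \<odot>\<^bsub>section_space M E\<^esub> \<psi>)"
    by (simp_all add: bundle_algebra_def)
  have zC: "\<zero>\<^bsub>?C\<^esub> \<in> carrier ?C" and zS: "\<zero>\<^bsub>?S\<^esub> \<in> carrier ?S"
    using assms zero_in_smooth_algebra zero_in_section_module by blast+
  have uM0: "uM \<zero>\<^bsub>?C\<^esub> = \<zero>\<^bsub>?C\<^esub>"
    by (rule linear_auto_zero[OF assms(3) zC]) (simp add: smooth_algebra_def)
  have u0: "u \<zero>\<^bsub>?S\<^esub> = \<zero>\<^bsub>?S\<^esub>"
    by (rule linear_auto_zero[OF assms(4)]) (use zS assms(2) in \<open>auto simp: space section_zero_smult\<close>)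
  have uM: "bij_betw uM (carrier ?C) (carrier ?C)"
    "\<And>f g. f \<in> carrier ?C \<Longrightarrow> g \<in> carrier ?C \<Longrightarrow> uM (f \<oplus>\<^bsub>?C\<^esub> g) = uM f \<oplus>\<^bsub>?C\<^esub> uM g"
    "\<And>c f. f \<in> carrier ?C \<Longrightarrow> uM (c \<odot>\<^bsub>?C\<^esub> f) = c \<odot>\<^bsub>?C\<^esub> uM f"
    using assms(3) by (auto simp: linear_auto_def)
  have u: "bij_betw u (carrier ?S) (carrier ?S)"
    "\<And>\<psi> \<xi>. \<psi> \<in> carrier ?S \<Longrightarrow> \<xi> \<in> carrier ?S \<Longrightarrow> u (\<psi> \<oplus>\<^bsub>?S\<^esub> \<xi>) = u \<psi> \<oplus>\<^bsub>?S\<^esub> u \<xi>"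
    "\<And>c \<psi>. \<psi> \<in> carrier ?S \<Longrightarrow> u (c \<odot>\<^bsub>section_space M E\<^esub> \<psi>) = c \<odot>\<^bsub>section_space M E\<^esub> u \<psi>"
    using assms(4) by (auto simp: linear_auto_def space)
  have uM_in: "\<And>f. f \<in> carrier ?C \<Longrightarrow> uM f \<in> carrier ?C"
    and u_in: "\<And>\<psi>. \<psi> \<in> carrier ?S \<Longrightarrow> u \<psi> \<in> carrier ?S"
    using uM(1) u(1) by (auto simp: bij_betw_def)
  have bij: "bij_betw (map_prod uM u) (carrier ?A) (carrier ?A)"
    unfolding A using uM(1) u(1) by (rule bij_betw_map_prod)
  show ?thesis
  proof
    assume "algebra_auto ?A (map_prod uM u)"
    then have mult: "\<And>p q. p \<in> carrier ?A \<Longrightarrow> q \<in> carrier ?A \<Longrightarrow>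
        map_prod uM u (p \<otimes>\<^bsub>?A\<^esub> q) = map_prod uM u p \<otimes>\<^bsub>?A\<^esub> map_prod uM u q"
      and one: "map_prod uM u \<one>\<^bsub>?A\<^esub> = \<one>\<^bsub>?A\<^esub>"
      by (auto simp: algebra_auto_def ring_iso_def ring_hom_def)
    have "uM (f \<otimes>\<^bsub>?C\<^esub> g) = uM f \<otimes>\<^bsub>?C\<^esub> uM g" if "f \<in> carrier ?C" "g \<in> carrier ?C" for f g
      \<comment> \<open>The function component of the product is f g, whatever the sections
        are.\<close>
      using mult[of "(f, \<zero>\<^bsub>?S\<^esub>)" "(g, \<zero>\<^bsub>?S\<^esub>)"] that zS by (simp add: A)
    moreover have "uM \<one>\<^bsub>?C\<^esub> = \<one>\<^bsub>?C\<^esub>" using one by (simp add: A)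
    ultimately have "algebra_auto ?C uM"
      using assms(3) uM uM_in by (auto simp: algebra_auto_def ring_iso_def ring_hom_def)
    moreover have "u (f \<odot>\<^bsub>?S\<^esub> \<psi>) = uM f \<odot>\<^bsub>?S\<^esub> u \<psi>"
      if "f \<in> carrier ?C" "\<psi> \<in> carrier ?S" for f \<psi>
      \<comment> \<open>The section component of this product is f \<psi>. On the image side it is
        uM f acting on u \<psi>, since both maps fix zero.\<close>
      using mult[of "(f, \<zero>\<^bsub>?S\<^esub>)" "(\<zero>\<^bsub>?C\<^esub>, \<psi>)"] that zC zS u_in
      by (simp add: A uM0 u0 section_smult_add_zero[OF assms(2)])
    ultimately show "algebra_auto ?C uM \<and> semilinear_iso M E uM u"
      using assms(4) by (simp add: semilinear_iso_def)
  next
    assume "algebra_auto ?C uM \<and> semilinear_iso M E uM u"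
    then have mult: "\<And>f g. f \<in> carrier ?C \<Longrightarrow> g \<in> carrier ?C \<Longrightarrow> uM (f \<otimes>\<^bsub>?C\<^esub> g) = uM f \<otimes>\<^bsub>?C\<^esub> uM g"
      and one: "uM \<one>\<^bsub>?C\<^esub> = \<one>\<^bsub>?C\<^esub>"
      and smult: "\<And>f \<psi>. f \<in> carrier ?C \<Longrightarrow> \<psi> \<in> carrier ?S \<Longrightarrow> u (f \<odot>\<^bsub>?S\<^esub> \<psi>) = uM f \<odot>\<^bsub>?S\<^esub> u \<psi>"
      by (auto simp: algebra_auto_def ring_iso_def ring_hom_def semilinear_iso_def)
    have "linear_auto ?A (map_prod uM u)"
      unfolding linear_auto_def using bij uM(2,3) u(2,3) by (auto simp: A)
    \<comment> \<open>Splitting u (f \<xi> + g \<psi>) by additivity requires f \<xi> and g \<psi>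
      to be smooth sections. The unit (1, 0) is preserved because u fixes the zero section.\<close>
    moreover have "map_prod uM u \<in> ring_iso ?A ?A"
      using bij uM(2) u(2) uM_in u_in
      by (auto simp: ring_iso_def ring_hom_def A one u0 mult smult
          smult_in_section_module[OF assms(1,2)])
    ultimately show "algebra_auto ?A (map_prod uM u)"
      by (simp add: algebra_auto_def)
  qed
qed

end
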